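(* Consider the nonlinear neutral delay difference system $$x(t+1)=A(t)x(t)+\Delta Q(t,x(t-g(t)))+G(t,x(t),x(t-g(t))),\qquad t\in\mathbb{Z},\tag{N}$$ where $A(t)$ is an $n\times n$ matrix function, $g:\mathbb{Z}\to\mathbb{Z}_+$ is scalar, and $Q:\mathbb{Z}\times\mathcal{X}\to\mathcal{X}$ and $G:\mathbb{Z}\times\mathcal{X}\times\mathcal{X}\to\mathcal{X}$ are continuous in their $\mathcal{X}$-variables. Assume: (1) $A(t)$, $g(t)$, $Q(t,u)$ and $G(t,u,v)$ are discrete almost automorphic in $t$ (for $Q$ and $G$: for each $u$, respectively each $(u,v)$). (2) There is a constant $E_1\in(0,1)$ such that $\|Q(t,\zeta)-Q(t,\psi)\|_{\mathcal{X}}\le E_1\|\zeta-\psi\|_{\mathcal{X}}$ for all $t\in\mathbb{Z}$ and $\zeta,\psi\in\mathcal{X}$. (3) There is a constant $E_2>0$ such that $\|G(t,u,\zeta)-G(t,v,\psi)\|_{\mathcal{X}}\le E_2\left(\|u-v\|_{\mathcal{X}}+\|\zeta-\psi\|_{\mathcal{X}}\right)$ for all $t\in\mathbb{Z}$ and $u,v,\zeta,\psi\in\mathcal{X}$. (4) The homogeneous system $x(t+1)=A(t)x(t)$, $x(t_0)=x_0$, admits an exponential dichotomy with projection $P$ and positive constants $\alpha_1,\alpha_2,\beta_1,\beta_2$. Put $a:=\sup_{t\in\mathbb{Z}}\|G(t,0,0)\|_{\mathcal{X}}$ and $b:=\sup_{t\in\mathbb{Z}}\|Q(t,0)\|_{\mathcal{X}}$,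 and let $M_0>0$ be a constant satisfying $$E_1M_0+b+\left[(\|A\|+1)(E_1M_0+b)+2E_2M_0+a\right]\left[\beta_1\frac{1+\alpha_1}{\alpha_1}+\frac{\beta_2}{\alpha_2}\right]\le M_0 .$$ Then (N) has an almost automorphic solution in $\Pi_{M_0}:=\{x\in\mathcal{A}(\mathcal{X}):\|x\|_{\mathcal{A}(\mathcal{X})}\le M_0\}$.
   Context: $\mathcal{X}$ is the space $\mathbb{R}^n$ or $\mathbb{C}^n$ with a norm $\|\cdot\|_{\mathcal{X}}$, and $\mathcal{B}(\mathcal{X})$ is the space of (bounded) linear operators on $\mathcal{X}$ with the operator norm $\|L\|_{\mathcal{B}(\mathcal{X})}=\sup\{\|Lx\|_{\mathcal{X}}:\|x\|_{\mathcal{X}}\le 1\}$. $\Delta$ is the forward difference operator in $t$: $\Delta h(t)=h(t+1)-h(t)$, so $\Delta Q(t,x(t-g(t)))=Q(t+1,x(t+1-g(t+1)))-Q(t,x(t-g(t)))$. $\mathbb{Z}_+$ is the set of positive integers. $\|A\|:=\sup_{t\in\mathbb{Z}}\max_{1\le i\le n}\sum_{j=1}^n|a_{ij}(t)|$, where $A(t)=(a_{ij}(t))$. Discrete almost automorphy: a function $f$ from $\mathbb{Z}$ to a Banach space is discrete almost automorphic if every integer sequence $\{k_n'\}$ has a subsequence $\{k_n\}$ such that $\bar f(t):=\lim_{n\to\infty}f(t+k_n)$ exists for each $t\in\mathbb{Z}$ and $\lim_{n\to\infty}\bar f(t-k_n)=f(t)$ for each $t\in\mathbb{Z}$. A function $h(t,x)$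 is discrete almost automorphic in $t$ for each $x$ if every integer sequence $\{k_n'\}$ has a subsequence $\{k_n\}$ such that $\bar h(t,x):=\lim_{n\to\infty}h(t+k_n,x)$ exists and $\lim_{n\to\infty}\bar h(t-k_n,x)=h(t,x)$ for each $t\in\mathbb{Z}$ and each $x$ (for $G$, $x=(u,v)\in\mathcal{X}\times\mathcal{X}$). $\mathcal{A}(\mathcal{X})$ is the Banach space of discrete almost automorphic functions $\mathbb{Z}\to\mathcal{X}$ with norm $\|f\|_{\mathcal{A}(\mathcal{X})}=\sup_{t\in\mathbb{Z}}\|f(t)\|_{\mathcal{X}}$. Fix $t_0\in\mathbb{Z}$. $X(t)$, $t\in\mathbb{Z}$, is the principal fundamental matrix solution of $x(t+1)=A(t)x(t)$, i.e. $X(t+1)=A(t)X(t)$ for all $t\in\mathbb{Z}$ and $X(t_0)=I$; the matrices $A(t)$ are invertible, so that $X^{-1}(s)$, the inverse of $X(s)$, exists. The system $x(t+1)=A(t)x(t)$, $x(t_0)=x_0$, admits an exponential dichotomy with projection $P$ (a matrix with $P^2=P$) and positive constants $\alpha_1,\alpha_2,\beta_1,\beta_2$ if, for $t,s\in\mathbb{Z}$, $\|X(t)PX^{-1}(s)\|_{\mathcal{B}(\mathcal{X})}\le\beta_1(1+\alpha_1)^{s-t}$ for $t\ge s$ and $\|X(t)(I-P)X^{-1}(s)\|_{\mathcal{B}(\mathcal{X})}\le\beta_2(1+\alpha_2)^{t-s}$ for $s\ge t$. Solution: $x:\mathbb{Z}\to\mathcal{X}$ is a solution of $x(t+1)=A(t)x(t)+f(t)$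 (where the forcing $f$ may depend on $x$) if for all $t\in\mathbb{Z}$ $$x(t)=\sum_{j=-\infty}^{t-1}X(t)PX^{-1}(j+1)f(j)-\sum_{j=t}^{\infty}X(t)(I-P)X^{-1}(j+1)f(j);$$ for (N), $f(j)=\Delta Q(j,x(j-g(j)))+G(j,x(j),x(j-g(j)))$.
   Formalization: The formal theorem additionally assumes that the operator norm of A(t) on X is at most ‖A‖ (the row-sum norm) for every t; for an arbitrary norm on X the statement without this compatibility is false. *)

theory Defs
  imports "HOL-Analysis.Analysis"
begin

text \<open>
  The space is \<open>'k ^ 'n\<close> with \<open>'k :: {real_normed_field, euclidean_space}\<close>. Both
  \<^typ>\<open>real\<close> and \<^typ>\<open>complex\<close> are instances, and up to isomorphism they are the only
  ones, so the dimension and the choice between the real and the complex case are both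
  universally quantified. The norm of the space is an arbitrary function \<open>nrm\<close>
  satisfying the norm axioms over \<open>'k\<close>, not the type-class norm of \<open>'k ^ 'n\<close>. All norms
  on \<open>'k ^ 'n\<close> are equivalent, so limits and continuity are those of the library topology.
\<close>

definition vector_norm :: "('k::real_normed_field ^ 'n \<Rightarrow> real) \<Rightarrow> bool" where
  "vector_norm nrm \<longleftrightarrow>
     (\<forall>x. nrm x \<ge> 0) \<and>
     (\<forall>x. nrm x = 0 \<longleftrightarrow> x = 0) \<and>
     (\<forall>x y. nrm (x + y) \<le> nrm x + nrm y) \<and>
     (\<forall>c x. nrm (c *s x) = norm c * nrm x)"

definition op_norm ::
  "('k::real_normed_field ^ 'n \<Rightarrow> real) \<Rightarrow> ('k ^ 'n \<Rightarrow> 'k ^ 'n) \<Rightarrow> real" where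
  "op_norm nrm L = (SUP x\<in>{x. nrm x \<le> 1}. nrm (L x))"

definition matrix_sup_norm :: "(int \<Rightarrow> 'k::real_normed_field ^ 'n ^ 'n) \<Rightarrow> real" where
  "matrix_sup_norm A = (SUP t. MAX i. \<Sum>j\<in>UNIV. norm (A t $ i $ j))"

definition discrete_aa :: "(int \<Rightarrow> 'b::banach) \<Rightarrow> bool" where
  "discrete_aa f \<longleftrightarrow>
     (\<forall>k' :: nat \<Rightarrow> int. \<exists>r :: nat \<Rightarrow> nat. strict_mono r \<and>
        (\<exists>fbar. (\<forall>t. (\<lambda>n. f (t + k' (r n))) \<longlonglongrightarrow> fbar t) \<and>
                (\<forall>t. (\<lambda>n. fbar (t - k' (r n))) \<longlonglongrightarrow> f t)))"

text \<open>The subsequence is chosen once for all values of the parameter.\<close>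

definition discrete_aa_param :: "(int \<Rightarrow> 'p \<Rightarrow> 'b::banach) \<Rightarrow> bool" where
  "discrete_aa_param h \<longleftrightarrow>
     (\<forall>k' :: nat \<Rightarrow> int. \<exists>r :: nat \<Rightarrow> nat. strict_mono r \<and>
        (\<exists>hbar. (\<forall>t p. (\<lambda>n. h (t + k' (r n)) p) \<longlonglongrightarrow> hbar t p) \<and>
                (\<forall>t p. (\<lambda>n. hbar (t - k' (r n)) p) \<longlonglongrightarrow> h t p)))"

definition sup_norm :: "('b \<Rightarrow> real) \<Rightarrow> (int \<Rightarrow> 'b) \<Rightarrow> real" where
  "sup_norm nrm f = (SUP t. nrm (f t))"

text \<open>Discrete almost automorphic functions are bounded, so the supremum is genuine here.\<close>

definition aa_ball :: "('b::banach \<Rightarrow> real) \<Rightarrow> real \<Rightarrow> (int \<Rightarrow> 'b) set" where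
  "aa_ball nrm M = {x. discrete_aa x \<and> sup_norm nrm x \<le> M}"

definition fwd_diff :: "(int \<Rightarrow> 'b::ab_group_add) \<Rightarrow> int \<Rightarrow> 'b" where
  "fwd_diff h t = h (t + 1) - h t"

definition principal_fundamental_matrix ::
  "(int \<Rightarrow> 'k::field ^ 'n ^ 'n) \<Rightarrow> int \<Rightarrow> (int \<Rightarrow> 'k ^ 'n ^ 'n) \<Rightarrow> bool" where
  "principal_fundamental_matrix A t0 X \<longleftrightarrow>
     X t0 = mat 1 \<and> (\<forall>t. X (t + 1) = A t ** X t)"

definition exp_dichotomy ::
  "('k::real_normed_field ^ 'n \<Rightarrow> real) \<Rightarrow> (int \<Rightarrow> 'k ^ 'n ^ 'n) \<Rightarrow> 'k ^ 'n ^ 'n \<Rightarrow>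
   real \<Rightarrow> real \<Rightarrow> real \<Rightarrow> real \<Rightarrow> bool" where
  "exp_dichotomy nrm X P \<alpha>1 \<alpha>2 \<beta>1 \<beta>2 \<longleftrightarrow>
     P ** P = P \<and> 0 < \<alpha>1 \<and> 0 < \<alpha>2 \<and> 0 < \<beta>1 \<and> 0 < \<beta>2 \<and>
     (\<forall>t s. t \<ge> s \<longrightarrow>
        op_norm nrm ((*v) (X t ** P ** matrix_inv (X s))) \<le> \<beta>1 * (1 + \<alpha>1) powi (s - t)) \<and>
     (\<forall>t s. s \<ge> t \<longrightarrow>
        op_norm nrm ((*v) (X t ** (mat 1 - P) ** matrix_inv (X s)))
          \<le> \<beta>2 * (1 + \<alpha>2) powi (t - s))"

text \<open>
  \<open>f\<close> is the forcing term along \<open>x\<close>. The two series run over \<open>j = t - 1, t - 2, \<dots>\<close> and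
  over \<open>j = t, t + 1, \<dots>\<close>; their convergence is part of the definition.
\<close>

definition dichotomy_solution ::
  "(int \<Rightarrow> 'k::{real_normed_field,euclidean_space} ^ 'n ^ 'n) \<Rightarrow> 'k ^ 'n ^ 'n \<Rightarrow>
   (int \<Rightarrow> 'k ^ 'n) \<Rightarrow> (int \<Rightarrow> 'k ^ 'n) \<Rightarrow> bool" where
  "dichotomy_solution X P f x \<longleftrightarrow>
     (\<forall>t. \<exists>u v.
        (\<lambda>m. let j = t - 1 - int m
             in (X t ** P ** matrix_inv (X (j + 1))) *v f j) sums u \<and>
        (\<lambda>m. let j = t + int m
             in (X t ** (mat 1 - P) ** matrix_inv (X (j + 1))) *v f j) sums v \<and>
        x t = u - v)"

definition neutral_forcing ::
  "(int \<Rightarrow> 'b::ab_group_add \<Rightarrow> 'b) \<Rightarrow> (int \<Rightarrow> 'b \<Rightarrow> 'b \<Rightarrow> 'b) \<Rightarrow> (int \<Rightarrow> int) \<Rightarrow>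
   (int \<Rightarrow> 'b) \<Rightarrow> int \<Rightarrow> 'b" where
  "neutral_forcing Q G g x j =
     fwd_diff (\<lambda>t. Q t (x (t - g t))) j + G j (x j) (x (j - g j))"

text \<open>
  The row-sum norm \<^const>\<open>matrix_sup_norm\<close> is the one induced by the maximum norm. For
  another choice of \<open>nrm\<close> the operator norm of \<open>A t\<close> need not be bounded by it, and the
  smallness condition on \<open>M0\<close> is then too weak for the existence theorem; compatibility of
  the two norms is therefore required explicitly. It holds automatically if \<open>nrm\<close> is the
  maximum norm.
\<close>

definition norm_compatible ::
  "('k::real_normed_field ^ 'n \<Rightarrow> real) \<Rightarrow> (int \<Rightarrow> 'k ^ 'n ^ 'n) \<Rightarrow> bool" where
  "norm_compatible nrm A \<longleftrightarrow> (\<forall>t. op_norm nrm ((*v) (A t)) \<le> matrix_sup_norm A)"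

end

theory Submission
  imports Defs "HOL-Complex_Analysis.Great_Picard"
begin

text \<open>
  The dichotomy gives a Green operator \<open>S\<close>: for bounded \<open>f\<close>, \<open>S f\<close> is the unique bounded solution
  of \<open>y (t + 1) = A t y t + f t\<close>. With \<open>q x t = Q t (x (t - g t))\<close>, the bounded solutions of (N) are
  therefore the bounded fixed points of \<open>T x = q x + S ((A - I) q x + G x)\<close>. Let \<open>L\<close> be the
  Lipschitz constant that the estimates give for \<open>T\<close>. The smallness condition on \<open>M0\<close> reads
  \<open>L M0 + c \<le> M0\<close>, where \<open>c \<ge> 0\<close> vanishes only if \<open>a = b = 0\<close>. So either \<open>L < 1\<close>, and \<open>T\<close> has a
  fixed point in the ball by Banach's principle, or
  \<open>a = b = 0\<close>, and the zero function is a solution.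

  Almost automorphy of the fixed point follows from uniqueness: translating (N) and the solution
  along \<open>k\<close> and then back along \<open>-k\<close>, and passing to limits each time, produces a bounded solution
  of (N), which must be the one we started from.
\<close>

section \<open>Limits of vectors and matrices, and boundedness of almost automorphic
  functions\<close>

lemma of_real_vector_smult:
  fixes x :: "'k::real_normed_field ^ 'n"
  shows "of_real r *s x = r *\<^sub>R x"
proof (rule vec_eq_iff[THEN iffD2], rule allI)
  show "(of_real r *s x) $ i = (r *\<^sub>R x) $ i" for i
    by (simp only: vector_smult_component vector_scaleR_component scaleR_conv_of_real[of r "x $ i"])
qed

lemma tendsto_matrix_vector_mult:
  fixes B :: "'a \<Rightarrow> 'k::real_normed_field ^ 'n ^ 'm"
  assumes "(B \<longlongrightarrow> B') F" and "(x \<longlongrightarrow> x') F"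
  shows "((\<lambda>n. B n *v x n) \<longlongrightarrow> B' *v x') F"
  unfolding matrix_vector_mult_def
  by (rule vec_tendstoI) (simp, intro tendsto_sum tendsto_mult tendsto_vec_nth assms)

text \<open>Otherwise some \<open>k\<close> satisfies \<open>norm (f (k n)) > n\<close> for all
  \<open>n\<close>, and no subsequence of \<open>f (k n)\<close> converges. This is why the suprema
  \<open>a\<close> and \<open>b\<close> of the theorem are genuine bounds.\<close>

lemma bounded_range_of_subseq:
  fixes f :: "'a \<Rightarrow> 'b::real_normed_vector"
  assumes "\<And>k :: nat \<Rightarrow> 'a. \<exists>r l. strict_mono r \<and> (\<lambda>n. f (k (r n))) \<longlonglongrightarrow> l"
  shows "bounded (range f)"
proof (rule ccontr)
  assume "\<not> bounded (range f)"
  then have "\<exists>t. norm (f t) > real n" for n :: nat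
    unfolding bounded_iff by (metis not_le rangeE)
  then obtain k where k: "\<And>n :: nat. norm (f (k n)) > real n" by metis
  from assms[of k] obtain r l where r: "strict_mono r" and l: "(\<lambda>n. f (k (r n))) \<longlonglongrightarrow> l" by blast
  from convergentI[OF l] obtain B where B: "\<And>n. norm (f (k (r n))) \<le> B"
    using convergent_imp_Bseq BseqE by metis
  obtain n :: nat where "B < real n" using reals_Archimedean2 by blast
  also have "real n \<le> real (r n)" using r by (simp add: seq_suble)
  also have "\<dots> < norm (f (k (r n)))" by (rule k)
  finally show False using B[of n] by simp
qed

text \<open>A diagonal argument over the countably many \<open>t\<close>, with Heine-Borel at each
  of them. It extracts limits of translates of a solution from boundedness alone, before the
  solution is known to be almost automorphic.\<close>

lemma bounded_family_convergent_subseq: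
  fixes f :: "nat \<Rightarrow> 'a::countable \<Rightarrow> 'b::{real_normed_vector,heine_borel}"
  assumes "\<And>n t. norm (f n t) \<le> M"
  obtains r l where "strict_mono r" "\<forall>t. (\<lambda>n. f (r n) t) \<longlonglongrightarrow> l t"
proof (rule function_convergent_subsequence[of "UNIV :: 'a set" f M])
  fix r :: "nat \<Rightarrow> nat"
  assume r: "strict_mono r" and "\<And>t. t \<in> UNIV \<Longrightarrow> \<exists>l. (\<lambda>n. f (r n) t) \<longlonglongrightarrow> l"
  then have "\<forall>t. (\<lambda>n. f (r n) t) \<longlonglongrightarrow> lim (\<lambda>n. f (r n) t)"
    by (simp add: convergent_def flip: convergent_LIMSEQ_iff)
  with r show thesis by (rule that)
qed (use assms in auto)

lemma discrete_aa_const: "discrete_aa (\<lambda>_. c)"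
  unfolding discrete_aa_def
  by (intro allI exI[of _ id] conjI exI[of _ "\<lambda>_. c"]) (simp_all add: strict_mono_def)

lemma discrete_aaE:
  fixes k :: "nat \<Rightarrow> int"
  assumes "discrete_aa f"
  obtains r fbar where "strict_mono r" "\<forall>t. (\<lambda>n. f (t + k (r n))) \<longlonglongrightarrow> fbar t"
    "\<forall>t. (\<lambda>n. fbar (t - k (r n))) \<longlonglongrightarrow> f t"
  using assms[unfolded discrete_aa_def, THEN spec[of _ k]] that by blast

lemma discrete_aa_paramE:
  fixes k :: "nat \<Rightarrow> int"
  assumes "discrete_aa_param h"
  obtains r hbar where "strict_mono r" "\<forall>t p. (\<lambda>n. h (t + k (r n)) p) \<longlonglongrightarrow> hbar t p"
    "\<forall>t p. (\<lambda>n. hbar (t - k (r n)) p) \<longlonglongrightarrow> h t p"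
  using assms[unfolded discrete_aa_param_def, THEN spec[of _ k]] that by blast

lemma discrete_aa_param_bounded:
  assumes "discrete_aa_param h"
  shows "bounded (range (\<lambda>t. h t p))"
proof (rule bounded_range_of_subseq)
  fix k :: "nat \<Rightarrow> int"
  show "\<exists>r l. strict_mono r \<and> (\<lambda>n. h (k (r n)) p) \<longlonglongrightarrow> l"
  proof (rule discrete_aa_paramE[OF assms, of k])
    fix r hbar
    assume r: "strict_mono r" and lim: "\<forall>t p. (\<lambda>n. h (t + k (r n)) p) \<longlonglongrightarrow> hbar t p"
    show ?thesis using r lim[rule_format, of 0 p] by auto
  qed
qed

text \<open>The integers are closed, and distinct ones are at distance at least 1. Applied to the
  delay, this yields an integer-valued limit delay and makes the translated delays eventually
  constant at each time.\<close>

lemma tendsto_real_of_int_eventually: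
  fixes h :: "nat \<Rightarrow> int"
  assumes "(\<lambda>n. real_of_int (h n)) \<longlonglongrightarrow> L"
  obtains i where "L = of_int i" "eventually (\<lambda>n. h n = i) sequentially"
proof -
  have "L \<in> \<int>"
    by (rule closed_sequentially[OF closed_Ints, of "\<lambda>n. real_of_int (h n)"]) (use assms in auto)
  then obtain i where i: "L = of_int i" by (auto elim: Ints_cases)
  have "eventually (\<lambda>n. dist (real_of_int (h n)) L < 1) sequentially"
    by (rule tendstoD[OF assms]) simp
  then have "eventually (\<lambda>n. h n = i) sequentially"
    by eventually_elim (auto simp: i dist_real_def simp flip: of_int_diff)
  with i show ?thesis by (rule that)
qed

section \<open>Arbitrary norms and contractions\<close>

locale vector_norm_space =
  fixes nrm :: "'k::{real_normed_field,euclidean_space} ^ 'n \<Rightarrow> real"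
  assumes vector_norm: "vector_norm nrm"
begin

lemma nrm_ge_0 [simp]: "0 \<le> nrm x"
  and nrm_eq_0_iff [simp]: "nrm x = 0 \<longleftrightarrow> x = 0"
  and nrm_triangle: "nrm (x + y) \<le> nrm x + nrm y"
  and nrm_smult: "nrm (c *s x) = norm c * nrm x"
  using vector_norm unfolding vector_norm_def by auto

lemma nrm_le_0_iff [simp]: "nrm x \<le> 0 \<longleftrightarrow> x = 0"
  using nrm_ge_0[of x] nrm_eq_0_iff[of x] by linarith

lemma nrm_zero [simp]: "nrm 0 = 0"
  by simp

lemma nrm_minus [simp]: "nrm (- x) = nrm x"
  using nrm_smult[of "-1" x] by (simp flip: vector_sneg_minus1)

lemma nrm_minus_commute: "nrm (x - y) = nrm (y - x)"
  using nrm_minus[of "x - y"] by simp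

lemma nrm_triangle_diff: "nrm (x - y) \<le> nrm x + nrm y"
  using nrm_triangle[of x "- y"] by simp

lemma nrm_scaleR: "nrm (r *\<^sub>R x) = \<bar>r\<bar> * nrm x"
  using nrm_smult[of "of_real r" x] by (simp add: of_real_vector_smult)

lemma nrm_sum: "nrm (sum f I) \<le> (\<Sum>i\<in>I. nrm (f i))"
proof (induction I rule: infinite_finite_induct)
  case (insert i I)
  then show ?case using nrm_triangle[of "f i" "sum f I"] by simp
qed simp_all

lemma nrm_abs_diff: "\<bar>nrm x - nrm y\<bar> \<le> nrm (x - y)"
  using nrm_triangle[of "x - y" y] nrm_triangle[of "y - x" x] nrm_minus_commute[of x y] by simp

text \<open>Expand in the basis. Adding 1 to the sum of the basis norms makes the constant visibly
  positive.\<close>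

lemma nrm_le_norm: "\<exists>C>0. \<forall>x. nrm x \<le> C * norm x"
proof -
  let ?C = "\<Sum>b\<in>Basis. nrm b"
  have "nrm x \<le> (?C + 1) * norm x" for x
  proof -
    have "nrm x = nrm (\<Sum>b\<in>Basis. (x \<bullet> b) *\<^sub>R b)" by (simp add: euclidean_representation)
    also have "\<dots> \<le> (\<Sum>b\<in>Basis. \<bar>x \<bullet> b\<bar> * nrm b)"
      by (rule order_trans[OF nrm_sum]) (simp add: nrm_scaleR)
    also have "\<dots> \<le> (\<Sum>b\<in>Basis. norm x * nrm b)"
      by (intro sum_mono mult_right_mono) (auto simp: Basis_le_norm)
    also have "\<dots> = ?C * norm x" by (simp add: sum_distrib_left mult.commute)
    also have "\<dots> \<le> (?C + 1) * norm x" by (simp add: distrib_right)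
    finally show ?thesis .
  qed
  moreover have "?C + 1 > 0" by (simp add: add_nonneg_pos sum_nonneg)
  ultimately show ?thesis by blast
qed

lemma continuous_on_nrm: "continuous_on S nrm"
proof -
  obtain C where C: "C > 0" "\<And>x. nrm x \<le> C * norm x" using nrm_le_norm by blast
  have "C-lipschitz_on S nrm"
  proof (rule lipschitz_onI)
    show "dist (nrm x) (nrm y) \<le> C * dist x y" for x y
      using order_trans[OF nrm_abs_diff C(2)] by (simp add: dist_norm)
  qed (use C in simp)
  then show ?thesis by (rule lipschitz_on_continuous_on)
qed

lemma tendsto_nrm [tendsto_intros]: "(f \<longlongrightarrow> l) F \<Longrightarrow> ((\<lambda>n. nrm (f n)) \<longlongrightarrow> nrm l) F"
  using continuous_on_nrm[of UNIV] continuous_on_tendsto_compose[of UNIV nrm f l F] by auto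

text \<open>By compactness \<open>nrm\<close> attains a minimum on the unit sphere; it is positive,
  and homogeneity carries the estimate to all vectors.\<close>

lemma norm_le_nrm: "\<exists>C>0. \<forall>x. norm x \<le> C * nrm x"
proof -
  let ?S = "sphere (0 :: 'k ^ 'n) 1"
  have "?S \<noteq> {}" by simp
  then obtain u where u: "u \<in> ?S" "\<And>y. y \<in> ?S \<Longrightarrow> nrm u \<le> nrm y"
    using continuous_attains_inf[OF compact_sphere _ continuous_on_nrm, of 0 1] by blast
  have pos: "nrm u > 0"
    using u(1) nrm_le_0_iff[of u] by (auto simp: not_le[symmetric] simp del: nrm_le_0_iff)
  have "norm x \<le> (1 / nrm u) * nrm x" for x
  proof (cases "x = 0")
    case False
    have "nrm u \<le> nrm ((1 / norm x) *\<^sub>R x)" using False by (intro u(2)) simp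
    then show ?thesis using pos False by (simp add: nrm_scaleR field_simps)
  qed simp
  then show ?thesis using pos by (intro exI[of _ "1 / nrm u"]) simp
qed

text \<open>Equivalence of norms: limits in the library topology can be checked with
  \<open>nrm\<close>.\<close>

lemma tendsto_iff_nrm: "(f \<longlongrightarrow> l) F \<longleftrightarrow> ((\<lambda>n. nrm (f n - l)) \<longlongrightarrow> 0) F"
proof
  assume "(f \<longlongrightarrow> l) F"
  then have "((\<lambda>n. nrm (f n - l)) \<longlongrightarrow> nrm (l - l)) F" by (intro tendsto_intros)
  then show "((\<lambda>n. nrm (f n - l)) \<longlongrightarrow> 0) F" by simp
next
  obtain C where C: "C > 0" "\<And>x. norm x \<le> C * nrm x" using norm_le_nrm by blast
  assume "((\<lambda>n. nrm (f n - l)) \<longlongrightarrow> 0) F"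
  then have "((\<lambda>n. C * nrm (f n - l)) \<longlongrightarrow> 0) F" by (rule tendsto_mult_right_zero)
  then have "((\<lambda>n. f n - l) \<longlongrightarrow> 0) F"
    by (rule Lim_null_comparison[rotated]) (simp add: C)
  then show "(f \<longlongrightarrow> l) F" by (rule LIM_zero_cancel)
qed

lemma nrm_limit_le:
  assumes "f \<longlonglongrightarrow> l" "\<And>n. nrm (f n) \<le> M"
  shows "nrm l \<le> M"
  by (rule LIMSEQ_le_const2[OF tendsto_nrm[OF assms(1)]]) (use assms(2) in auto)

text \<open>The equivalence of norms serves only for convergence. The bound \<open>C\<close> is
  passed through the partial sums in \<open>nrm\<close> itself, so no equivalence constant enters
  the later estimates.\<close>

lemma nrm_summable:
  assumes "\<And>m. nrm (f m) \<le> c m" and "c sums C"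
  shows "summable f" and "nrm (suminf f) \<le> C"
proof -
  obtain D where D: "D > 0" "\<And>x. norm x \<le> D * nrm x" using norm_le_nrm by blast
  have le: "norm (f m) \<le> D * c m" for m
    using D(2)[of "f m"] assms(1)[of m] mult_left_mono[of "nrm (f m)" "c m" D] D(1) by linarith
  have "summable (\<lambda>m. D * c m)"
    using assms(2) by (intro summable_mult) (rule sums_summable)
  then show f: "summable f" by (rule summable_comparison_test') (rule le)
  show "nrm (suminf f) \<le> C"
  proof (rule nrm_limit_le[OF summable_LIMSEQ[OF f]])
    fix n
    have "c m \<ge> 0" for m using order_trans[OF nrm_ge_0 assms(1)] .
    then have "(\<Sum>m<n. c m) \<le> C"
      using sum_le_suminf[OF sums_summable[OF assms(2)], of "{..<n}"] sums_unique[OF assms(2)] by simp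
    moreover have "nrm (\<Sum>m<n. f m) \<le> (\<Sum>m<n. c m)"
      by (rule order_trans[OF nrm_sum sum_mono[OF assms(1)]])
    ultimately show "nrm (\<Sum>m<n. f m) \<le> C" by simp
  qed
qed

section \<open>The operator norm induced by an arbitrary norm\<close>

text \<open>Without this bound the real supremum in \<open>op_norm\<close> would carry no
  information.\<close>

lemma bdd_above_op_norm:
  fixes B :: "'k ^ 'n ^ 'n"
  shows "bdd_above ((\<lambda>x. nrm (B *v x)) ` {x. nrm x \<le> 1})"
proof -
  obtain C where C: "C > 0" "\<And>x. norm x \<le> C * nrm x" using norm_le_nrm by blast
  obtain D where D: "D > 0" "\<And>x. nrm x \<le> D * norm x" using nrm_le_norm by blast
  obtain K where K: "K > 0" "\<And>x. norm (B *v x) \<le> norm x * K"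
    using bounded_linear.pos_bounded[OF matrix_vector_mul_bounded_linear[of B]] by blast
  have "nrm (B *v x) \<le> D * (C * K)" if "nrm x \<le> 1" for x
  proof -
    have "norm x \<le> C" using C(2)[of x] mult_left_mono[OF that, of C] C(1) by linarith
    then have "norm (B *v x) \<le> C * K" using K(2)[of x] mult_right_mono[of "norm x" C K] K(1) by linarith
    then show ?thesis using D(2)[of "B *v x"] mult_left_mono[of "norm (B *v x)" "C * K" D] D(1) by linarith
  qed
  then show ?thesis by (intro bdd_aboveI2) auto
qed

lemma op_norm_ge_0: "0 \<le> op_norm nrm ((*v) B)" for B :: "'k ^ 'n ^ 'n"
proof -
  have "nrm (B *v 0) \<le> op_norm nrm ((*v) B)"
    unfolding op_norm_def by (rule cSUP_upper[OF _ bdd_above_op_norm]) simp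
  then show ?thesis using nrm_ge_0 order_trans by blast
qed

lemma nrm_mult_le_op_norm: "nrm (B *v x) \<le> op_norm nrm ((*v) B) * nrm x" for B :: "'k ^ 'n ^ 'n"
proof (cases "x = 0")
  case False
  define c where "c = 1 / nrm x"
  have pos: "nrm x > 0" using False nrm_ge_0[of x] nrm_eq_0_iff[of x] by linarith
  have eq: "B *v (c *\<^sub>R x) = c *\<^sub>R (B *v x)"
    using matrix_vector_mul_bounded_linear[of B] by (rule linear_cmul[OF bounded_linear.linear])
  have "nrm (B *v (c *\<^sub>R x)) \<le> op_norm nrm ((*v) B)"
    unfolding op_norm_def by (rule cSUP_upper[OF _ bdd_above_op_norm])
      (use pos in \<open>simp add: nrm_scaleR c_def\<close>)
  then show ?thesis using pos unfolding eq by (simp add: nrm_scaleR c_def field_simps)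
qed simp

lemma nrm_mult_le:
  fixes B :: "'k ^ 'n ^ 'n"
  assumes "op_norm nrm ((*v) B) \<le> c" and "nrm x \<le> d"
  shows "nrm (B *v x) \<le> c * d"
proof -
  have "op_norm nrm ((*v) B) * nrm x \<le> c * d"
    using assms op_norm_ge_0[of B] by (intro mult_mono) auto
  then show ?thesis using nrm_mult_le_op_norm[of B x] by linarith
qed

lemma tendsto_of_nrm_le:
  assumes "\<And>n. nrm (f n - l) \<le> e n" and "e \<longlonglongrightarrow> 0"
  shows "f \<longlonglongrightarrow> l"
  unfolding tendsto_iff_nrm
  by (rule tendsto_sandwich[OF _ _ tendsto_const assms(2)]) (use assms(1) in auto)

text \<open>The maps \<open>h n\<close> converge only pointwise; control of their increments lets
  the argument vary with \<open>n\<close> as well. In the applications \<open>e n\<close> comes from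
  a Lipschitz constant independent of \<open>n\<close>.\<close>

lemma equi_Lipschitz_tendsto:
  assumes "(\<lambda>n. h n p) \<longlonglongrightarrow> l" and "e \<longlonglongrightarrow> 0"
    and "\<And>n. nrm (h n (q n) - h n p) \<le> e n"
  shows "(\<lambda>n. h n (q n)) \<longlonglongrightarrow> l"
proof -
  have "(\<lambda>n. h n (q n) - h n p) \<longlonglongrightarrow> 0"
    by (rule tendsto_of_nrm_le[OF _ assms(2)]) (use assms(3) in simp)
  from tendsto_add[OF this assms(1)] show ?thesis by simp
qed

section \<open>Contractions with respect to the supremum norm\<close>

text \<open>Picard iteration from the zero function. Supremum distances are expressed by uniform
  bounds \<open>d\<close>, so no metric space of bounded functions has to be set up.\<close>

lemma bounded_contraction_fixed_point:
  fixes T :: "('i \<Rightarrow> 'k ^ 'n) \<Rightarrow> 'i \<Rightarrow> 'k ^ 'n"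
  assumes M: "0 \<le> M" and L: "0 \<le> L" "L < 1"
    and T: "\<And>x t. (\<And>s. nrm (x s) \<le> M) \<Longrightarrow> nrm (T x t) \<le> M"
    and lip: "\<And>x y d t. (\<And>s. nrm (x s) \<le> M) \<Longrightarrow> (\<And>s. nrm (y s) \<le> M) \<Longrightarrow>
       (\<And>s. nrm (x s - y s) \<le> d) \<Longrightarrow> nrm (T x t - T y t) \<le> L * d"
  shows "\<exists>x. (\<forall>t. nrm (x t) \<le> M) \<and> T x = x"
proof -
  define w where "w n = (T ^^ n) (\<lambda>_. 0)" for n
  have w_Suc: "w (Suc n) = T (w n)" for n by (simp add: w_def)
  have wM: "nrm (w n t) \<le> M" for n t
    by (induction n arbitrary: t) (use M T in \<open>auto simp: w_def\<close>)
  have step: "nrm (w (Suc n) t - w n t) \<le> L ^ n * M" for n t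
  proof (induction n arbitrary: t)
    case 0
    then show ?case using wM[of 1 t] by (simp add: w_def)
  next
    case (Suc n)
    have "nrm (T (w (Suc n)) t - T (w n) t) \<le> L * (L ^ n * M)"
      by (rule lip[OF wM[of "Suc n"] wM[of n] Suc.IH])
    then show ?case by (simp only: w_Suc power_Suc mult.assoc)
  qed
  have geo: "(\<lambda>n. L ^ n * M) sums (1 / (1 - L) * M)"
    using L by (intro sums_mult2 geometric_sums) simp
  \<comment> \<open>Since \<open>w 0 = 0\<close>, the partial sums of this telescoping series are
    the iterates; its terms are dominated by the geometric series \<open>geo\<close>.\<close>
  define x where "x t = (\<Sum>n. w (Suc n) t - w n t)" for t
  have tail: "nrm (x t - w n t) \<le> L ^ n * (1 / (1 - L) * M)" for n t
  proof -
    have s: "summable (\<lambda>n. w (Suc n) t - w n t)" using nrm_summable(1)[OF step geo] .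
    have "x t = (\<Sum>m. w (Suc (m + n)) t - w (m + n) t) + (\<Sum>m<n. w (Suc m) t - w m t)"
      unfolding x_def using suminf_split_initial_segment[OF s, of n] by simp
    also have "(\<Sum>m<n. w (Suc m) t - w m t) = w n t"
      using sum_lessThan_telescope[of "\<lambda>m. w m t" n] by (simp add: w_def)
    finally have "x t - w n t = (\<Sum>m. w (Suc (m + n)) t - w (m + n) t)" by simp
    moreover have "nrm (w (Suc (m + n)) t - w (m + n) t) \<le> L ^ n * (L ^ m * M)" for m
      using step[of "m + n" t] by (simp add: power_add mult_ac)
    ultimately show ?thesis using nrm_summable(2)[OF _ sums_mult[OF geo, of "L ^ n"]] by simp
  qed
  have Ln: "(\<lambda>n. L ^ n * c) \<longlonglongrightarrow> 0" for c
    using L by (intro tendsto_mult_left_zero LIMSEQ_realpow_zero)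
  have lim: "(\<lambda>n. w n t) \<longlonglongrightarrow> x t" for t
    by (rule tendsto_of_nrm_le[OF _ Ln]) (subst nrm_minus_commute, rule tail)
  have xM: "nrm (x t) \<le> M" for t by (rule nrm_limit_le[OF lim wM])
  have "T x t = x t" for t
  proof (rule LIMSEQ_unique)
    show "(\<lambda>n. w (Suc n) t) \<longlonglongrightarrow> x t" by (rule LIMSEQ_Suc[OF lim])
    \<comment> \<open>Pointwise convergence of the iterates would not suffice: \<open>lip\<close>
      asks for a bound uniform in \<open>s\<close>, which \<open>tail\<close> supplies.\<close>
    have "nrm (w (Suc n) t - T x t) \<le> L * (L ^ n * (1 / (1 - L) * M))" for n
      unfolding w_Suc by (subst nrm_minus_commute) (use xM wM tail in \<open>intro lip\<close>)
    moreover have "(\<lambda>n. L * (L ^ n * (1 / (1 - L) * M))) \<longlonglongrightarrow> 0"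
      by (intro tendsto_mult_right_zero Ln)
    ultimately show "(\<lambda>n. w (Suc n) t) \<longlonglongrightarrow> T x t"
      by (rule tendsto_of_nrm_le)
  qed
  then show ?thesis using xM by (intro exI[of _ x]) (simp add: fun_eq_iff)
qed

text \<open>Each use of \<open>lip\<close> improves a uniform bound by the factor \<open>L\<close>,
  so the distance is at most \<open>L ^ n * D\<close> for every \<open>n\<close>.\<close>

lemma contraction_unique:
  fixes x y :: "'i \<Rightarrow> 'k ^ 'n"
  assumes L: "0 \<le> L" "L < 1"
    and bound: "\<And>t. nrm (x t - y t) \<le> D"
    and lip: "\<And>d t. (\<And>s. nrm (x s - y s) \<le> d) \<Longrightarrow> nrm (x t - y t) \<le> L * d"
  shows "x = y"
proof
  fix t
  have "nrm (x t - y t) \<le> L ^ n * D" for n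
  proof (induction n arbitrary: t)
    case (Suc n)
    from lip[OF this] show ?case by (simp add: mult.assoc)
  qed (use bound in simp)
  moreover have "(\<lambda>n. L ^ n * D) \<longlonglongrightarrow> 0"
    using L by (intro tendsto_mult_left_zero LIMSEQ_realpow_zero)
  ultimately have "nrm (x t - y t) \<le> 0" by (intro LIMSEQ_le_const[where X = "\<lambda>n. L ^ n * D"]) auto
  then show "x t = y t" by simp
qed

end

section \<open>The Green operator of an exponential dichotomy\<close>

lemma matrix_inv_left: "invertible B \<Longrightarrow> matrix_inv B ** B = mat 1"
  and matrix_inv_right: "invertible B \<Longrightarrow> B ** matrix_inv B = mat 1"
  unfolding invertible_def matrix_inv_def by (metis (mono_tags, lifting) someI_ex)+

locale dichotomous_system = vector_norm_space nrm
  for nrm :: "'k::{real_normed_field,euclidean_space} ^ 'n \<Rightarrow> real" +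
  fixes A X :: "int \<Rightarrow> 'k ^ 'n ^ 'n" and P :: "'k ^ 'n ^ 'n" and t0 :: int
    and \<alpha>1 \<alpha>2 \<beta>1 \<beta>2 :: real
  assumes invertible_A: "invertible (A t)"
    and fundamental: "principal_fundamental_matrix A t0 X"
    and dichotomy: "exp_dichotomy nrm X P \<alpha>1 \<alpha>2 \<beta>1 \<beta>2"
begin

section \<open>The fundamental matrix and the two evolution kernels\<close>

lemma X_Suc: "X (t + 1) = A t ** X t"
  using fundamental unfolding principal_fundamental_matrix_def by blast

text \<open>Induction in both directions from \<open>t0\<close>; the backward step solves the
  recurrence for \<open>X (t - 1)\<close> by inverting \<open>A (t - 1)\<close>.\<close>

lemma invertible_X: "invertible (X t)"
proof (induction t rule: int_induct[of _ t0])
  case base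
  show ?case using fundamental
    by (auto simp: principal_fundamental_matrix_def invertible_def intro: exI[of _ "mat 1"])
next
  case (step1 t)
  then show ?case using invertible_A by (auto simp: X_Suc intro: invertible_mult)
next
  case (step2 t)
  have "matrix_inv (A (t - 1)) ** X t = (matrix_inv (A (t - 1)) ** A (t - 1)) ** X (t - 1)"
    using X_Suc[of "t - 1"] by (simp add: matrix_mul_assoc)
  also have "\<dots> = X (t - 1)" using invertible_A by (simp add: matrix_inv_left)
  finally have "X (t - 1) = matrix_inv (A (t - 1)) ** X t" ..
  moreover have "invertible (matrix_inv (A (t - 1)))"
    using invertible_A[of "t - 1"] matrix_inv_left matrix_inv_right unfolding invertible_def by blast
  ultimately show ?case using step2 by (simp add: invertible_mult)
qed

lemma matrix_inv_X_Suc: "matrix_inv (X (t + 1)) ** A t = matrix_inv (X t)"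
proof -
  have "matrix_inv (X (t + 1)) ** A t = matrix_inv (X (t + 1)) ** A t ** (X t ** matrix_inv (X t))"
    by (simp add: matrix_inv_right invertible_X)
  also have "\<dots> = matrix_inv (X (t + 1)) ** X (t + 1) ** matrix_inv (X t)"
    by (simp add: X_Suc matrix_mul_assoc)
  finally show ?thesis by (simp add: matrix_inv_left invertible_X)
qed

text \<open>With \<open>unstable\<close>, this forms the Green kernel of the dichotomy:
  \<open>stable t s\<close> decays as \<open>s\<close> moves into the past of \<open>t\<close>,
  \<open>unstable t s\<close> as \<open>s\<close> moves into its future.\<close>

definition stable :: "int \<Rightarrow> int \<Rightarrow> 'k ^ 'n ^ 'n" where
  "stable t s = X t ** P ** matrix_inv (X s)"

definition unstable :: "int \<Rightarrow> int \<Rightarrow> 'k ^ 'n ^ 'n" where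
  "unstable t s = X t ** (mat 1 - P) ** matrix_inv (X s)"

lemma stable_Suc_left: "stable (t + 1) s = A t ** stable t s"
  and unstable_Suc_left: "unstable (t + 1) s = A t ** unstable t s"
  by (simp_all add: stable_def unstable_def X_Suc matrix_mul_assoc)

text \<open>Consequently \<open>stable t s *v z s\<close> does not depend on \<open>s\<close> along
  a solution \<open>z\<close> of the homogeneous system, and likewise for
  \<open>unstable\<close>.\<close>

lemma stable_Suc_right: "stable t (s + 1) ** A s = stable t s"
  and unstable_Suc_right: "unstable t (s + 1) ** A s = unstable t s"
  by (simp_all only: stable_def unstable_def matrix_mul_assoc[symmetric] matrix_inv_X_Suc)

lemma stable_plus_unstable: "stable t t *v z + unstable t t *v z = z"
proof -
  define w where "w = matrix_inv (X t) *v z"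
  have "stable t t *v z + unstable t t *v z = X t *v (P *v w) + X t *v ((mat 1 - P) *v w)"
    by (simp add: stable_def unstable_def w_def matrix_vector_mul_assoc matrix_mul_assoc)
  also have "\<dots> = X t *v w"
    by (simp add: matrix_vector_mult_diff_rdistrib flip: matrix_vector_right_distrib)
  also have "\<dots> = z" by (simp add: w_def matrix_vector_mul_assoc matrix_inv_right invertible_X)
  finally show ?thesis .
qed

lemma constants_pos: "0 < \<alpha>1" "0 < \<alpha>2" "0 < \<beta>1" "0 < \<beta>2"
  using dichotomy unfolding exp_dichotomy_def by auto

lemma op_norm_stable: "op_norm nrm ((*v) (stable t (t - int m))) \<le> \<beta>1 * (1 / (1 + \<alpha>1)) ^ m"
proof -
  have "op_norm nrm ((*v) (stable t (t - int m))) \<le> \<beta>1 * (1 + \<alpha>1) powi (t - int m - t)"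
    using dichotomy unfolding exp_dichotomy_def stable_def by (metis le_add_same_cancel1
        of_nat_0_le_iff diff_add_cancel)
  then show ?thesis by (simp add: power_int_minus power_one_over inverse_eq_divide)
qed

lemma op_norm_unstable: "op_norm nrm ((*v) (unstable t (t + int m))) \<le> \<beta>2 * (1 / (1 + \<alpha>2)) ^ m"
proof -
  have "op_norm nrm ((*v) (unstable t (t + int m))) \<le> \<beta>2 * (1 + \<alpha>2) powi (t - (t + int m))"
    using dichotomy unfolding exp_dichotomy_def unstable_def by (metis le_add_same_cancel1
        of_nat_0_le_iff)
  then show ?thesis by (simp add: power_int_minus power_one_over inverse_eq_divide)
qed

section \<open>The Green operator as a solution operator\<close>

text \<open>Sum of two geometric series, with ratio \<open>1 / (1 + \<alpha>1)\<close> from exponent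
  0 and ratio \<open>1 / (1 + \<alpha>2)\<close> from exponent 1. It is the last factor in the
  smallness condition.\<close>

definition green_bound :: real where
  "green_bound = \<beta>1 * ((1 + \<alpha>1) / \<alpha>1) + \<beta>2 / \<alpha>2"

lemma green_bound_pos: "0 < green_bound"
  unfolding green_bound_def using constants_pos by (intro add_pos_pos) auto

text \<open>With \<open>j = t - 1 - m\<close> in the first sum and \<open>j = t + m\<close> in the
  second, the second kernel argument is \<open>j + 1\<close>; these are the series of
  \<open>dichotomy_solution\<close>.\<close>

definition green :: "(int \<Rightarrow> 'k ^ 'n) \<Rightarrow> int \<Rightarrow> 'k ^ 'n" where
  "green f t = (\<Sum>m. stable t (t - int m) *v f (t - 1 - int m)) -
               (\<Sum>m. unstable t (t + int m + 1) *v f (t + int m))"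

context
  fixes f :: "int \<Rightarrow> 'k ^ 'n" and F :: real
  assumes f_le: "\<And>t. nrm (f t) \<le> F"
begin

lemma stable_series:
  shows summable_stable: "summable (\<lambda>m. stable t (t - int m) *v f (t - 1 - int m))"
    and "nrm (\<Sum>m. stable t (t - int m) *v f (t - 1 - int m)) \<le> \<beta>1 * ((1 + \<alpha>1) / \<alpha>1) * F"
proof -
  have "(\<lambda>m. \<beta>1 * (1 / (1 + \<alpha>1)) ^ m * F) sums (\<beta>1 * (1 / (1 - 1 / (1 + \<alpha>1))) * F)"
    using constants_pos by (intro sums_mult sums_mult2 geometric_sums) simp
  moreover have "1 / (1 - 1 / (1 + \<alpha>1)) = (1 + \<alpha>1) / \<alpha>1"
    using constants_pos by (simp add: field_simps)
  ultimately have s: "(\<lambda>m. \<beta>1 * (1 / (1 + \<alpha>1)) ^ m * F) sums (\<beta>1 * ((1 + \<alpha>1) / \<alpha>1) * F)"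
    by simp
  note le = nrm_mult_le[OF op_norm_stable f_le]
  show "summable (\<lambda>m. stable t (t - int m) *v f (t - 1 - int m))"
    by (rule nrm_summable(1)[OF le s])
  show "nrm (\<Sum>m. stable t (t - int m) *v f (t - 1 - int m)) \<le> \<beta>1 * ((1 + \<alpha>1) / \<alpha>1) * F"
    by (rule nrm_summable(2)[OF le s])
qed

lemma unstable_series:
  shows summable_unstable: "summable (\<lambda>m. unstable t (t + int m + 1) *v f (t + int m))"
    and "nrm (\<Sum>m. unstable t (t + int m + 1) *v f (t + int m)) \<le> \<beta>2 / \<alpha>2 * F"
proof -
  \<comment> \<open>The kernel is evaluated at distance \<open>m + 1\<close> from \<open>t\<close>,
    so the geometric series starts at exponent 1.\<close>
  have "(\<lambda>m. \<beta>2 * (1 / (1 + \<alpha>2)) ^ Suc m * F) sums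
      (\<beta>2 * (1 / (1 + \<alpha>2) * (1 / (1 - 1 / (1 + \<alpha>2)))) * F)"
    unfolding power_Suc using constants_pos by (intro sums_mult sums_mult2 geometric_sums) simp
  moreover have "\<beta>2 * (1 / (1 + \<alpha>2) * (1 / (1 - 1 / (1 + \<alpha>2)))) = \<beta>2 / \<alpha>2"
    using constants_pos by (simp add: field_simps)
  ultimately have s: "(\<lambda>m. \<beta>2 * (1 / (1 + \<alpha>2)) ^ Suc m * F) sums (\<beta>2 / \<alpha>2 * F)"
    by (simp only:)
  have le: "nrm (unstable t (t + int m + 1) *v f (t + int m)) \<le> \<beta>2 * (1 / (1 + \<alpha>2)) ^ Suc m * F" for m
    using nrm_mult_le[OF op_norm_unstable f_le, of t "Suc m" "t + int m"] by (simp add: ac_simps)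
  show "summable (\<lambda>m. unstable t (t + int m + 1) *v f (t + int m))"
    by (rule nrm_summable(1)[OF le s])
  show "nrm (\<Sum>m. unstable t (t + int m + 1) *v f (t + int m)) \<le> \<beta>2 / \<alpha>2 * F"
    by (rule nrm_summable(2)[OF le s])
qed

lemma nrm_green_le: "nrm (green f t) \<le> green_bound * F"
  using nrm_triangle_diff stable_series(2)[of t] unstable_series(2)[of t]
  unfolding green_def green_bound_def distrib_right by (smt (verit))

lemma dichotomy_solution_green: "dichotomy_solution X P f (green f)"
  unfolding dichotomy_solution_def
proof
  fix t
  show "\<exists>u v. (\<lambda>m. let j = t - 1 - int m in (X t ** P ** matrix_inv (X (j + 1))) *v f j) sums u \<and>
    (\<lambda>m. let j = t + int m in (X t ** (mat 1 - P) ** matrix_inv (X (j + 1))) *v f j) sums v \<and>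
    green f t = u - v"
    using summable_sums[OF summable_stable[of t]] summable_sums[OF summable_unstable[of t]]
    unfolding green_def stable_def unstable_def Let_def by force
qed

text \<open>Compared with \<open>A t\<close> applied to the series at \<open>t\<close>, the stable
  series at \<open>t + 1\<close> gains a first term and the unstable one loses its first term. The
  two terms are the complementary projections of \<open>f t\<close> at time \<open>t + 1\<close>,
  which add up to \<open>f t\<close>.\<close>

lemma green_recurrence: "green f (t + 1) = A t *v green f t + f t"
proof -
  have lin: "A t *v (\<Sum>m. h m) = (\<Sum>m. A t *v h m)" if "summable h" for h
    by (rule bounded_linear.suminf[OF matrix_vector_mul_bounded_linear that])
  define u where "u m = stable t (t - int m) *v f (t - 1 - int m)" for m
  define v where "v m = unstable t (t + int m + 1) *v f (t + int m)" for m
  have u: "summable u" and v: "summable v"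
    using summable_stable[of t] summable_unstable[of t] unfolding u_def v_def .
  have "(\<Sum>m. stable (t + 1) (t + 1 - int m) *v f (t + 1 - 1 - int m)) =
      stable (t + 1) (t + 1) *v f t +
      (\<Sum>m. stable (t + 1) (t + 1 - int (Suc m)) *v f (t + 1 - 1 - int (Suc m)))"
    using suminf_split_head[OF summable_stable[of "t + 1"]] by simp
  also have "(\<lambda>m. stable (t + 1) (t + 1 - int (Suc m)) *v f (t + 1 - 1 - int (Suc m))) =
      (\<lambda>m. A t *v u m)"
    by (simp add: fun_eq_iff u_def stable_Suc_left matrix_vector_mul_assoc diff_diff_eq)
  finally have 1: "(\<Sum>m. stable (t + 1) (t + 1 - int m) *v f (t + 1 - 1 - int m)) =
      stable (t + 1) (t + 1) *v f t + A t *v suminf u" by (simp add: lin[OF u])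
  have "(\<lambda>m. unstable (t + 1) (t + 1 + int m + 1) *v f (t + 1 + int m)) = (\<lambda>m. A t *v v (Suc m))"
    by (simp add: fun_eq_iff v_def matrix_vector_mul_assoc add_ac flip: unstable_Suc_left)
  then have "(\<Sum>m. unstable (t + 1) (t + 1 + int m + 1) *v f (t + 1 + int m)) =
      A t *v (\<Sum>m. v (Suc m))"
    using lin[of "\<lambda>m. v (Suc m)"] v by (simp add: summable_Suc_iff)
  also have "(\<Sum>m. v (Suc m)) = suminf v - v 0"
    using suminf_split_head[OF v] by simp
  also have "A t *v (suminf v - v 0) = A t *v suminf v - unstable (t + 1) (t + 1) *v f t"
    by (simp add: matrix_vector_mult_diff_distrib v_def unstable_Suc_left matrix_vector_mul_assoc)
  finally have 2: "(\<Sum>m. unstable (t + 1) (t + 1 + int m + 1) *v f (t + 1 + int m)) =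
      A t *v suminf v - unstable (t + 1) (t + 1) *v f t" .
  have "green f t = suminf u - suminf v" unfolding green_def u_def v_def ..
  then have "A t *v green f t = A t *v suminf u - A t *v suminf v"
    by (simp add: matrix_vector_mult_diff_distrib)
  moreover have "green f (t + 1) = A t *v suminf u - A t *v suminf v +
      (stable (t + 1) (t + 1) *v f t + unstable (t + 1) (t + 1) *v f t)"
    unfolding green_def 1 2 by simp
  ultimately show ?thesis by (simp add: stable_plus_unstable)
qed

end

lemma green_diff:
  assumes "\<And>t. nrm (f t) \<le> F" and "\<And>t. nrm (h t) \<le> H"
  shows "green (\<lambda>t. f t - h t) t = green f t - green h t"
  unfolding green_def matrix_vector_mult_diff_distrib
    suminf_diff[OF summable_stable[where f = f, OF assms(1)] summable_stable[where f = h, OF assms(2)], symmetric]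
    suminf_diff[OF summable_unstable[where f = f, OF assms(1)] summable_unstable[where f = h, OF assms(2)], symmetric]
  by simp

section \<open>Uniqueness of bounded solutions of the linear equation\<close>

lemma geometric_null:
  assumes "0 < \<alpha>" and "\<And>m. nrm z \<le> c * (1 / (1 + \<alpha>)) ^ m * B"
  shows "z = 0"
proof -
  have "(\<lambda>m. c * (1 / (1 + \<alpha>)) ^ m * B) \<longlonglongrightarrow> 0"
    using assms(1) by (intro tendsto_mult_left_zero tendsto_mult_right_zero LIMSEQ_realpow_zero) auto
  then have "nrm z \<le> 0"
    by (rule LIMSEQ_le_const) (use assms(2) in auto)
  then show ?thesis by simp
qed

text \<open>\<open>stable t s *v z s\<close> is constant in \<open>s\<close>. As \<open>s\<close>
  tends to minus infinity the kernel decays while \<open>z\<close> stays bounded, so the stable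
  component vanishes; \<open>s\<close> tending to plus infinity settles the unstable one.\<close>

lemma bounded_homogeneous_solution:
  assumes rec: "\<And>t. z (t + 1) = A t *v z t" and bound: "\<And>t. nrm (z t) \<le> B"
  shows "z t = 0"
proof -
  have s: "stable t (t - int m) *v z (t - int m) = stable t t *v z t" for m
  proof (induction m)
    case (Suc m)
    have "stable t (t - int (Suc m)) *v z (t - int (Suc m)) =
        stable t (t - int (Suc m) + 1) *v z (t - int (Suc m) + 1)"
      unfolding rec matrix_vector_mul_assoc stable_Suc_right ..
    then show ?case using Suc by simp
  qed simp
  have u: "unstable t (t + int m) *v z (t + int m) = unstable t t *v z t" for m
  proof (induction m)
    case (Suc m)
    have "unstable t (t + int m) *v z (t + int m) = unstable t (t + int m + 1) *v z (t + int m + 1)"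
      unfolding rec matrix_vector_mul_assoc unstable_Suc_right ..
    then show ?case using Suc by (simp add: ac_simps)
  qed simp
  have "stable t t *v z t = 0"
    by (rule geometric_null[OF constants_pos(1)])
      (subst s[symmetric], rule nrm_mult_le[OF op_norm_stable bound])
  moreover have "unstable t t *v z t = 0"
    by (rule geometric_null[OF constants_pos(2)])
      (subst u[symmetric], rule nrm_mult_le[OF op_norm_unstable bound])
  ultimately show ?thesis using stable_plus_unstable[of t "z t"] by simp
qed

text \<open>The difference of \<open>y\<close> and \<open>green f\<close> is a bounded homogeneous
  solution. Bounded solutions can therefore be handled through the recurrence, and the series
  recovered at the end.\<close>

lemma bounded_solution_eq_green:
  assumes rec: "\<And>t. y (t + 1) = A t *v y t + f t"
    and y: "\<And>t. nrm (y t) \<le> B" and f: "\<And>t. nrm (f t) \<le> F"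
  shows "y = green f"
proof
  fix t
  have "y t - green f t = 0"
  proof (rule bounded_homogeneous_solution)
    show "y (t + 1) - green f (t + 1) = A t *v (y t - green f t)" for t
      by (simp add: rec green_recurrence[where f = f, OF f] matrix_vector_mult_diff_distrib)
    show "nrm (y t - green f t) \<le> B + green_bound * F" for t
      using nrm_triangle_diff[of "y t" "green f t"] y[of t] nrm_green_le[where f = f, OF f, of t] by linarith
  qed
  then show "y t = green f t" by simp
qed

end

section \<open>The neutral equation\<close>

lemma tendsto_subseq:
  assumes "f \<longlonglongrightarrow> l" and "strict_mono r"
  shows "(\<lambda>n. f (r n)) \<longlonglongrightarrow> l"
  using LIMSEQ_subseq_LIMSEQ[OF assms] by (simp add: o_def)

lemma neutral_forcing_shift:
  "neutral_forcing (\<lambda>t. Q (t + k)) (\<lambda>t. G (t + k)) (\<lambda>t. g (t + k)) (\<lambda>t. x (t + k)) t =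
   neutral_forcing Q G g x (t + k)"
  by (simp add: neutral_forcing_def fwd_diff_def algebra_simps)

text \<open>Formulated for arbitrary sequences of coefficients because it is applied twice: to
  translates of the given system and to back-translates of the limit system.\<close>

lemma (in vector_norm_space) neutral_equation_limit:
  fixes An :: "nat \<Rightarrow> int \<Rightarrow> 'k ^ 'n ^ 'n" and xn :: "nat \<Rightarrow> int \<Rightarrow> 'k ^ 'n"
  assumes A: "\<And>t. (\<lambda>n. An n t) \<longlonglongrightarrow> A t"
    and Q: "\<And>t u. (\<lambda>n. Qn n t u) \<longlonglongrightarrow> Q t u"
    and G: "\<And>t u v. (\<lambda>n. Gn n t u v) \<longlonglongrightarrow> G t u v"
    and g: "\<And>t. eventually (\<lambda>n. gn n t = g t) sequentially"
    and x: "\<And>t. (\<lambda>n. xn n t) \<longlonglongrightarrow> x t"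
    and Q_lip: "\<And>n t u v. nrm (Qn n t u - Qn n t v) \<le> E1 * nrm (u - v)"
    and G_lip: "\<And>n t u v u' v'. nrm (Gn n t u u' - Gn n t v v') \<le> E2 * (nrm (u - v) + nrm (u' - v'))"
    and eq: "\<And>n t. xn n (t + 1) = An n t *v xn n t + neutral_forcing (Qn n) (Gn n) (gn n) (xn n) t"
  shows "x (t + 1) = A t *v x t + neutral_forcing Q G g x t"
proof -
  have null: "(\<lambda>n. nrm (f n - l)) \<longlonglongrightarrow> 0" if "f \<longlonglongrightarrow> l" for f :: "nat \<Rightarrow> 'k ^ 'n" and l
    using that by (simp add: tendsto_iff_nrm)
  \<comment> \<open>The delays at \<open>t\<close> are eventually constant, so the argument is
    eventually fixed and pointwise convergence of \<open>xn\<close> is enough.\<close>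
  have delay: "(\<lambda>n. xn n (t - gn n t)) \<longlonglongrightarrow> x (t - g t)" for t
  proof (rule Lim_transform_eventually[OF x])
    show "eventually (\<lambda>n. xn n (t - g t) = xn n (t - gn n t)) sequentially"
      using g[of t] by eventually_elim simp
  qed
  have q: "(\<lambda>n. Qn n t (xn n (t - gn n t))) \<longlonglongrightarrow> Q t (x (t - g t))" for t
    by (rule equi_Lipschitz_tendsto[where h = "\<lambda>n. Qn n t", OF Q _ Q_lip])
      (rule tendsto_mult_right_zero[OF null[OF delay]])
  have G': "(\<lambda>n. (\<lambda>(u, v). Gn n t u v) (xn n t, xn n (t - gn n t))) \<longlonglongrightarrow> G t (x t) (x (t - g t))" for t
  proof (rule equi_Lipschitz_tendsto[where h = "\<lambda>n (u, v). Gn n t u v" and p = "(x t, x (t - g t))"])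
    show "(\<lambda>n. E2 * (nrm (xn n t - x t) + nrm (xn n (t - gn n t) - x (t - g t)))) \<longlonglongrightarrow> 0"
      using tendsto_add[OF null[OF x[of t]] null[OF delay[of t]]] by (intro tendsto_mult_right_zero) simp
  qed (use G G_lip in auto)
  show ?thesis
  proof (rule LIMSEQ_unique)
    show "(\<lambda>n. xn n (t + 1)) \<longlonglongrightarrow> x (t + 1)" by (rule x)
    have "(\<lambda>n. An n t *v xn n t + neutral_forcing (Qn n) (Gn n) (gn n) (xn n) t) \<longlonglongrightarrow>
        A t *v x t + neutral_forcing Q G g x t"
      unfolding neutral_forcing_def fwd_diff_def
      by (intro tendsto_add tendsto_diff tendsto_matrix_vector_mult A x q G'[simplified])
    then show "(\<lambda>n. xn n (t + 1)) \<longlonglongrightarrow> A t *v x t + neutral_forcing Q G g x t"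
      by (simp only: eq)
  qed
qed

text \<open>The suprema of the theorem appear as pointwise bounds \<open>N\<close>, \<open>a\<close>
  and \<open>b\<close>, the form in which the estimates use them.\<close>

locale neutral_system = dichotomous_system nrm A X P t0 \<alpha>1 \<alpha>2 \<beta>1 \<beta>2
  for nrm :: "'k::{real_normed_field,euclidean_space} ^ 'n \<Rightarrow> real"
    and A X P t0 \<alpha>1 \<alpha>2 \<beta>1 \<beta>2 +
  fixes Q :: "int \<Rightarrow> 'k ^ 'n \<Rightarrow> 'k ^ 'n" and G :: "int \<Rightarrow> 'k ^ 'n \<Rightarrow> 'k ^ 'n \<Rightarrow> 'k ^ 'n"
    and g :: "int \<Rightarrow> int" and N E1 E2 a b :: real
  assumes op_norm_A: "op_norm nrm ((*v) (A t)) \<le> N"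
    and E1_nonneg: "0 \<le> E1" and E2_nonneg: "0 \<le> E2"
    and Q_Lipschitz: "nrm (Q t u - Q t v) \<le> E1 * nrm (u - v)"
    and G_Lipschitz: "nrm (G t u u' - G t v v') \<le> E2 * (nrm (u - v) + nrm (u' - v'))"
    and Q_zero_le: "nrm (Q t 0) \<le> b"
    and G_zero_le: "nrm (G t 0 0) \<le> a"
begin

section \<open>The fixed-point operator and its estimates\<close>

definition delayed :: "(int \<Rightarrow> 'k ^ 'n) \<Rightarrow> int \<Rightarrow> 'k ^ 'n" where
  "delayed x t = Q t (x (t - g t))"

text \<open>The forcing in the equation for \<open>x - delayed x\<close>: subtracting
  \<open>delayed x (t + 1)\<close> from both sides of (N) leaves this beside
  \<open>A t *v (x t - delayed x t)\<close>.\<close>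

definition perturbation :: "(int \<Rightarrow> 'k ^ 'n) \<Rightarrow> int \<Rightarrow> 'k ^ 'n" where
  "perturbation x t = A t *v delayed x t - delayed x t + G t (x t) (x (t - g t))"

definition neutral_operator :: "(int \<Rightarrow> 'k ^ 'n) \<Rightarrow> int \<Rightarrow> 'k ^ 'n" where
  "neutral_operator x t = delayed x t + green (perturbation x) t"

text \<open>The coefficient of \<open>M0\<close> on the left of the smallness condition when
  \<open>N\<close> is the norm of \<open>A\<close>.\<close>

definition contraction_constant :: real where
  "contraction_constant = E1 + ((N + 1) * E1 + 2 * E2) * green_bound"

lemma N_nonneg: "0 \<le> N"
  using op_norm_ge_0 op_norm_A order_trans by blast

lemma contraction_constant_nonneg: "0 \<le> contraction_constant"
  unfolding contraction_constant_def
  using E1_nonneg E2_nonneg N_nonneg green_bound_pos by simp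

text \<open>Shared by the size and the Lipschitz estimates of \<open>perturbation\<close>, which
  have the same shape.\<close>

lemma nrm_combination_le:
  assumes "nrm q \<le> c"
  shows "nrm (A t *v q - q + w) \<le> (N + 1) * c + nrm w"
  using nrm_mult_le[OF op_norm_A[of t] assms] nrm_triangle[of "A t *v q - q" w]
    nrm_triangle_diff[of "A t *v q" q] assms by (simp add: distrib_right)

lemma delayed_diff_le:
  assumes "\<And>s. nrm (x s - y s) \<le> d"
  shows "nrm (delayed x t - delayed y t) \<le> E1 * d"
  using order_trans[OF Q_Lipschitz mult_left_mono[OF assms E1_nonneg]] by (simp add: delayed_def)

lemma delayed_le:
  assumes "\<And>s. nrm (x s) \<le> M"
  shows "nrm (delayed x t) \<le> E1 * M + b"
  using delayed_diff_le[of x "\<lambda>_. 0" M t] assms Q_zero_le[of t]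
    nrm_triangle[of "delayed x t - Q t 0" "Q t 0"]
  by (simp add: delayed_def)

text \<open>The factor 2 of \<open>E2\<close> arises because \<open>G\<close> sees \<open>x\<close>
  both at \<open>t\<close> and at \<open>t - g t\<close>.\<close>

lemma perturbation_diff_le:
  assumes "\<And>s. nrm (x s - y s) \<le> d"
  shows "nrm (perturbation x t - perturbation y t) \<le> ((N + 1) * E1 + 2 * E2) * d"
proof -
  let ?w = "G t (x t) (x (t - g t)) - G t (y t) (y (t - g t))"
  have "nrm ?w \<le> E2 * (d + d)"
    by (rule order_trans[OF G_Lipschitz]) (intro mult_left_mono add_mono assms E2_nonneg)
  moreover have eq: "perturbation x t - perturbation y t =
      A t *v (delayed x t - delayed y t) - (delayed x t - delayed y t) + ?w"
    by (simp add: perturbation_def matrix_vector_mult_diff_distrib)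
  have "nrm (perturbation x t - perturbation y t) \<le> (N + 1) * (E1 * d) + nrm ?w"
    unfolding eq by (rule nrm_combination_le[OF delayed_diff_le[OF assms]])
  ultimately show ?thesis by (simp add: algebra_simps)
qed

lemma perturbation_le:
  assumes "\<And>s. nrm (x s) \<le> M"
  shows "nrm (perturbation x t) \<le> (N + 1) * (E1 * M + b) + 2 * E2 * M + a"
proof -
  let ?w = "G t (x t) (x (t - g t))"
  have "nrm (?w - G t 0 0) \<le> E2 * (nrm (x t - 0) + nrm (x (t - g t) - 0))"
    by (rule G_Lipschitz)
  also have "\<dots> \<le> E2 * (M + M)"
    using assms by (intro mult_left_mono add_mono E2_nonneg) simp_all
  finally have "nrm ?w \<le> 2 * E2 * M + a"
    using nrm_triangle[of "?w - G t 0 0" "G t 0 0"] G_zero_le[of t] by simp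
  then show ?thesis
    using nrm_combination_le[OF delayed_le[of x, OF assms], of t t ?w] by (simp add: perturbation_def)
qed

text \<open>The bound \<open>B\<close> only guarantees that the Green series converge, so that they
  may be subtracted; it does not enter the constant.\<close>

lemma neutral_operator_diff_le:
  assumes x: "\<And>s. nrm (x s) \<le> B" and y: "\<And>s. nrm (y s) \<le> B" and d: "\<And>s. nrm (x s - y s) \<le> d"
  shows "nrm (neutral_operator x t - neutral_operator y t) \<le> contraction_constant * d"
proof -
  have "green (perturbation x) t - green (perturbation y) t =
      green (\<lambda>t. perturbation x t - perturbation y t) t"
    by (rule green_diff[symmetric]) (rule perturbation_le[OF x], rule perturbation_le[OF y])
  moreover have "nrm (green (\<lambda>t. perturbation x t - perturbation y t) t) \<le>
      green_bound * (((N + 1) * E1 + 2 * E2) * d)"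
    by (rule nrm_green_le) (rule perturbation_diff_le[OF d])
  moreover have "nrm (delayed x t - delayed y t) \<le> E1 * d" by (rule delayed_diff_le[OF d])
  moreover have "neutral_operator x t - neutral_operator y t =
      (delayed x t - delayed y t) + (green (perturbation x) t - green (perturbation y) t)"
    by (simp add: neutral_operator_def)
  ultimately have "nrm (neutral_operator x t - neutral_operator y t) \<le>
      E1 * d + green_bound * (((N + 1) * E1 + 2 * E2) * d)"
    using nrm_triangle[of "delayed x t - delayed y t"
        "green (perturbation x) t - green (perturbation y) t"] by simp
  then show ?thesis by (simp add: contraction_constant_def algebra_simps)
qed

lemma neutral_operator_le:
  assumes x: "\<And>s. nrm (x s) \<le> M"
    and M: "E1 * M + b + ((N + 1) * (E1 * M + b) + 2 * E2 * M + a) * green_bound \<le> M"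
  shows "nrm (neutral_operator x t) \<le> M"
proof -
  have "nrm (green (perturbation x) t) \<le> green_bound * ((N + 1) * (E1 * M + b) + 2 * E2 * M + a)"
    by (rule nrm_green_le) (rule perturbation_le[OF x])
  then show ?thesis
    using nrm_triangle[of "delayed x t" "green (perturbation x) t"] delayed_le[of x M t, OF x] M
    unfolding neutral_operator_def by (simp add: mult.commute)
qed

text \<open>
  Substituting \<open>y = x - delayed x\<close> removes the difference of \<open>Q\<close> from the forcing; this
  replaces the summation by parts in the dichotomy series.
\<close>

lemma neutral_equation_iff_fixed_point:
  assumes x: "\<And>s. nrm (x s) \<le> B"
  shows "(\<forall>t. x (t + 1) = A t *v x t + neutral_forcing Q G g x t) \<longleftrightarrow> neutral_operator x = x"
proof
  assume eq: "\<forall>t. x (t + 1) = A t *v x t + neutral_forcing Q G g x t"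
  have "(\<lambda>t. x t - delayed x t) = green (perturbation x)"
  proof (rule bounded_solution_eq_green)
    show "x (t + 1) - delayed x (t + 1) = A t *v (x t - delayed x t) + perturbation x t" for t
      using eq by (simp add: perturbation_def neutral_forcing_def fwd_diff_def delayed_def
          matrix_vector_mult_diff_distrib)
    show "nrm (x t - delayed x t) \<le> B + (E1 * B + b)" for t
      using nrm_triangle_diff[of "x t" "delayed x t"] x[of t] delayed_le[of x B t, OF x] by linarith
  qed (rule perturbation_le[OF x])
  then show "neutral_operator x = x"
    by (auto simp: neutral_operator_def fun_eq_iff algebra_simps)
next
  assume fixed: "neutral_operator x = x"
  show "\<forall>t. x (t + 1) = A t *v x t + neutral_forcing Q G g x t"
  proof
    fix t
    have x_eq: "x s = delayed x s + green (perturbation x) s" for s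
      using fun_cong[OF fixed, of s] by (simp add: neutral_operator_def)
    have "x (t + 1) = delayed x (t + 1) + (A t *v green (perturbation x) t + perturbation x t)"
      unfolding x_eq[of "t + 1"]
      using green_recurrence[where f = "perturbation x", OF perturbation_le[of x, OF x], of t] by simp
    also have "green (perturbation x) t = x t - delayed x t"
      using x_eq[of t] by simp
    finally show "x (t + 1) = A t *v x t + neutral_forcing Q G g x t"
      by (simp add: perturbation_def neutral_forcing_def fwd_diff_def delayed_def
          matrix_vector_mult_diff_distrib)
  qed
qed

text \<open>The forcing equals \<open>x (t + 1) - A t *v x t\<close> and is thus bounded, so
  \<open>x\<close> is the Green operator applied to its own forcing.\<close>

lemma dichotomy_solution_of_equation:
  assumes x: "\<And>s. nrm (x s) \<le> B"
    and eq: "\<And>t. x (t + 1) = A t *v x t + neutral_forcing Q G g x t"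
  shows "dichotomy_solution X P (neutral_forcing Q G g x) x"
proof -
  have f: "nrm (neutral_forcing Q G g x t) \<le> B + N * B" for t
  proof -
    have "neutral_forcing Q G g x t = x (t + 1) - A t *v x t" using eq[of t] by simp
    then show ?thesis
      using nrm_triangle_diff[of "x (t + 1)" "A t *v x t"] x[of "t + 1"]
        nrm_mult_le[OF op_norm_A[of t] x[of t]] by simp
  qed
  have "x = green (neutral_forcing Q G g x)"
    by (rule bounded_solution_eq_green[OF eq x f])
  then show ?thesis
    using dichotomy_solution_green[where f = "neutral_forcing Q G g x", OF f] by simp
qed

section \<open>Uniqueness, almost automorphy and existence for the neutral equation\<close>

text \<open>Both functions are fixed points of \<open>neutral_operator\<close>. The common bound
  \<open>B\<close> is arbitrary, so uniqueness holds among all bounded solutions.\<close>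

lemma bounded_equation_unique:
  assumes L: "contraction_constant < 1"
    and x: "\<And>s. nrm (x s) \<le> B" and y: "\<And>s. nrm (y s) \<le> B"
    and x_eq: "\<And>t. x (t + 1) = A t *v x t + neutral_forcing Q G g x t"
    and y_eq: "\<And>t. y (t + 1) = A t *v y t + neutral_forcing Q G g y t"
  shows "x = y"
proof (rule contraction_unique[OF contraction_constant_nonneg L])
  show "nrm (x t - y t) \<le> B + B" for t
    using nrm_triangle_diff[of "x t" "y t"] x[of t] y[of t] by linarith
  have "neutral_operator x = x" "neutral_operator y = y"
    using neutral_equation_iff_fixed_point[of x, OF x] neutral_equation_iff_fixed_point[of y, OF y]
      x_eq y_eq by blast+
  then show "nrm (x t - y t) \<le> contraction_constant * d" if "\<And>s. nrm (x s - y s) \<le> d" for d t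
    using neutral_operator_diff_le[of x B y d t] x y that by simp
qed

lemma bounded_equation_discrete_aa:
  assumes L: "contraction_constant < 1"
    and x: "\<And>s. nrm (x s) \<le> B"
    and eq: "\<And>t. x (t + 1) = A t *v x t + neutral_forcing Q G g x t"
    and aa_A: "discrete_aa A" and aa_g: "discrete_aa (\<lambda>t. real_of_int (g t))"
    and aa_Q: "discrete_aa_param Q" and aa_G: "discrete_aa_param (\<lambda>t (u, v). G t u v)"
  shows "discrete_aa x"
  unfolding discrete_aa_def
proof
  fix k :: "nat \<Rightarrow> int"
  obtain C where C: "C > 0" "\<And>v. norm v \<le> C * nrm v" using norm_le_nrm by blast
  have norm_le: "norm v \<le> C * B" if "nrm v \<le> B" for v
    using C(2)[of v] mult_left_mono[OF that, of C] C(1) by linarith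
  obtain r1 A' where r1: "strict_mono r1" and A'_all: "\<forall>t. (\<lambda>n. A (t + k (r1 n))) \<longlonglongrightarrow> A' t"
    and A''_all: "\<forall>t. (\<lambda>n. A' (t - k (r1 n))) \<longlonglongrightarrow> A t"
    by (rule discrete_aaE[OF aa_A, of k]) (rule that)
  note A' = A'_all[rule_format] and A'' = A''_all[rule_format]
  obtain r2 h where r2: "strict_mono r2"
    and h_all: "\<forall>t. (\<lambda>n. real_of_int (g (t + k (r1 (r2 n))))) \<longlonglongrightarrow> h t"
    and h'_all: "\<forall>t. (\<lambda>n. h (t - k (r1 (r2 n)))) \<longlonglongrightarrow> real_of_int (g t)"
    by (rule discrete_aaE[OF aa_g, of "\<lambda>n. k (r1 n)"]) (rule that)
  note h = h_all[rule_format] and h' = h'_all[rule_format]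
  obtain r3 Q' where r3: "strict_mono r3"
    and Q'_all: "\<forall>t u. (\<lambda>n. Q (t + k (r1 (r2 (r3 n)))) u) \<longlonglongrightarrow> Q' t u"
    and Q''_all: "\<forall>t u. (\<lambda>n. Q' (t - k (r1 (r2 (r3 n)))) u) \<longlonglongrightarrow> Q t u"
    by (rule discrete_aa_paramE[OF aa_Q, of "\<lambda>n. k (r1 (r2 n))"]) (rule that)
  note Q' = Q'_all[rule_format] and Q'' = Q''_all[rule_format]
  obtain r4 G2 where r4: "strict_mono r4"
    and G2_all: "\<forall>t p. (\<lambda>n. (\<lambda>(u, v). G (t + k (r1 (r2 (r3 (r4 n))))) u v) p) \<longlonglongrightarrow> G2 t p"
    and G2'_all: "\<forall>t p. (\<lambda>n. G2 (t - k (r1 (r2 (r3 (r4 n))))) p) \<longlonglongrightarrow> (\<lambda>(u, v). G t u v) p"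
    by (rule discrete_aa_paramE[OF aa_G, of "\<lambda>n. k (r1 (r2 (r3 n)))"]) (rule that)
  note G2 = G2_all[rule_format] and G2' = G2'_all[rule_format]
  \<comment> \<open>The first four extractions came from the coefficients; this one uses only that
    \<open>x\<close> is bounded.\<close>
  obtain r5 x' where r5: "strict_mono r5"
    and x'_all: "\<forall>t. (\<lambda>n. x (t + k (r1 (r2 (r3 (r4 (r5 n))))))) \<longlonglongrightarrow> x' t"
    by (rule bounded_family_convergent_subseq[OF norm_le[OF x],
          of "\<lambda>n t. t + k (r1 (r2 (r3 (r4 n))))"]) (rule that)
  note x' = x'_all[rule_format]
  have x'_le: "nrm (x' t) \<le> B" for t by (rule nrm_limit_le[OF x' x])
  \<comment> \<open>At this point \<open>x''\<close> is merely some limit of back-translates; that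
    it equals \<open>x\<close> is the goal.\<close>
  obtain r6 x'' where r6: "strict_mono r6"
    and x''_all: "\<forall>t. (\<lambda>n. x' (t - k (r1 (r2 (r3 (r4 (r5 (r6 n)))))))) \<longlonglongrightarrow> x'' t"
    by (rule bounded_family_convergent_subseq[OF norm_le[OF x'_le],
          of "\<lambda>n t. t - k (r1 (r2 (r3 (r4 (r5 n)))))"]) (rule that)
  note x'' = x''_all[rule_format]
  have x''_le: "nrm (x'' t) \<le> B" for t by (rule nrm_limit_le[OF x'' x'_le])
  \<comment> \<open>Each \<open>s\<close> collects the extractions made after a given stage, so
    every earlier limit can be restricted to the common subsequence \<open>r\<close>.\<close>
  define s4 where "s4 n = r5 (r6 n)" for n
  define s3 where "s3 n = r4 (s4 n)" for n
  define s2 where "s2 n = r3 (s3 n)" for n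
  define s1 where "s1 n = r2 (s2 n)" for n
  define r where "r n = r1 (s1 n)" for n
  note s_defs = s1_def s2_def s3_def s4_def
  have mono: "strict_mono s4" "strict_mono s3" "strict_mono s2" "strict_mono s1" "strict_mono r"
    using r1 r2 r3 r4 r5 r6 by (simp_all add: strict_mono_def r_def s_defs)
  define G' where "G' t u v = G2 t (u, v)" for t u v
  \<comment> \<open>The limit delay is obtained as a real function and must be integer-valued to
    serve as a delay.\<close>
  have "\<exists>i. h t = real_of_int i" for t using tendsto_real_of_int_eventually[OF h[of t]] by metis
  then obtain g' where g': "\<And>t. h t = real_of_int (g' t)" by metis
  have g_lim: "eventually (\<lambda>n. g (t + k (r n)) = g' t) sequentially"
    and g'_lim: "eventually (\<lambda>n. g' (t - k (r n)) = g t) sequentially" for t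
  proof -
    have "(\<lambda>n. real_of_int (g (t + k (r n)))) \<longlonglongrightarrow> real_of_int (g' t)"
      and "(\<lambda>n. real_of_int (g' (t - k (r n)))) \<longlonglongrightarrow> real_of_int (g t)"
      using tendsto_subseq[OF h mono(3), of t] tendsto_subseq[OF h' mono(3), of t]
      by (simp_all add: r_def s1_def g')
    then show "eventually (\<lambda>n. g (t + k (r n)) = g' t) sequentially"
      and "eventually (\<lambda>n. g' (t - k (r n)) = g t) sequentially"
      by (metis tendsto_real_of_int_eventually of_int_eq_iff)+
  qed
  have lims: "(\<lambda>n. A (t + k (r n))) \<longlonglongrightarrow> A' t" "(\<lambda>n. A' (t - k (r n))) \<longlonglongrightarrow> A t"
    "(\<lambda>n. Q (t + k (r n)) u) \<longlonglongrightarrow> Q' t u" "(\<lambda>n. Q' (t - k (r n)) u) \<longlonglongrightarrow> Q t u"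
    "(\<lambda>n. G (t + k (r n)) u v) \<longlonglongrightarrow> G' t u v" "(\<lambda>n. G' (t - k (r n)) u v) \<longlonglongrightarrow> G t u v"
    "(\<lambda>n. x (t + k (r n))) \<longlonglongrightarrow> x' t" for t u v
    using tendsto_subseq[OF A' mono(4), of t] tendsto_subseq[OF A'' mono(4), of t]
      tendsto_subseq[OF Q' mono(2), of t u] tendsto_subseq[OF Q'' mono(2), of t u]
      tendsto_subseq[OF G2 mono(1), of t "(u, v)"] tendsto_subseq[OF G2' mono(1), of t "(u, v)"]
      tendsto_subseq[OF x' r6, of t]
    by (simp_all add: r_def s_defs G'_def)
  \<comment> \<open>The limit coefficients inherit the Lipschitz constants, as the second passage to
    the limit requires.\<close>
  have Q'_lip: "nrm (Q' t u - Q' t v) \<le> E1 * nrm (u - v)" for t u v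
    by (rule nrm_limit_le[OF tendsto_diff[OF lims(3) lims(3)]]) (rule Q_Lipschitz)
  have G'_lip: "nrm (G' t u u' - G' t v v') \<le> E2 * (nrm (u - v) + nrm (u' - v'))" for t u u' v v'
    by (rule nrm_limit_le[OF tendsto_diff[OF lims(5) lims(5)]]) (rule G_Lipschitz)
  have eq': "x' (t + 1) = A' t *v x' t + neutral_forcing Q' G' g' x' t" for t
  proof (rule neutral_equation_limit)
    show "x (t + 1 + k (r n)) = A (t + k (r n)) *v x (t + k (r n)) +
        neutral_forcing (\<lambda>t. Q (t + k (r n))) (\<lambda>t. G (t + k (r n))) (\<lambda>t. g (t + k (r n)))
          (\<lambda>t. x (t + k (r n))) t" for n t
      using eq[of "t + k (r n)"] by (simp add: neutral_forcing_shift ac_simps)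
  qed (rule lims g_lim Q_Lipschitz G_Lipschitz)+
  \<comment> \<open>Translating back restores the original coefficients by the second half of almost
    automorphy.\<close>
  have eq'': "x'' (t + 1) = A t *v x'' t + neutral_forcing Q G g x'' t" for t
  proof (rule neutral_equation_limit)
    show "x' (t + 1 - k (r n)) = A' (t - k (r n)) *v x' (t - k (r n)) +
        neutral_forcing (\<lambda>t. Q' (t - k (r n))) (\<lambda>t. G' (t - k (r n))) (\<lambda>t. g' (t - k (r n)))
          (\<lambda>t. x' (t - k (r n))) t" for n t
      using eq'[of "t - k (r n)"]
        neutral_forcing_shift[of Q' "- k (r n)" G' g' x' t] by (simp add: algebra_simps)
    show "(\<lambda>n. x' (t - k (r n))) \<longlonglongrightarrow> x'' t" for t using x'' by (simp add: r_def s_defs)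
  qed (rule lims g'_lim Q'_lip G'_lip)+
  have "x'' = x" by (rule bounded_equation_unique[OF L x''_le x eq'' eq])
  then show "\<exists>r. strict_mono r \<and> (\<exists>fbar. (\<forall>t. (\<lambda>n. x (t + k (r n))) \<longlonglongrightarrow> fbar t) \<and>
      (\<forall>t. (\<lambda>n. fbar (t - k (r n))) \<longlonglongrightarrow> x t))"
    using lims(7) x'' mono(5) by (intro exI[of _ r] exI[of _ x'] conjI allI) (simp_all add: r_def s_defs)
qed

lemma exists_bounded_solution:
  assumes L: "contraction_constant < 1" and M: "0 \<le> M"
    "E1 * M + b + ((N + 1) * (E1 * M + b) + 2 * E2 * M + a) * green_bound \<le> M"
  shows "\<exists>x. (\<forall>t. nrm (x t) \<le> M) \<and> (\<forall>t. x (t + 1) = A t *v x t + neutral_forcing Q G g x t)"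
proof -
  have "\<exists>x. (\<forall>t. nrm (x t) \<le> M) \<and> neutral_operator x = x"
  proof (rule bounded_contraction_fixed_point[OF M(1) contraction_constant_nonneg L])
    show "nrm (neutral_operator x t) \<le> M" if "\<And>s. nrm (x s) \<le> M" for x t
      by (rule neutral_operator_le[OF that M(2)])
    show "nrm (neutral_operator x t - neutral_operator y t) \<le> contraction_constant * d"
      if "\<And>s. nrm (x s) \<le> M" "\<And>s. nrm (y s) \<le> M" "\<And>s. nrm (x s - y s) \<le> d" for x y d t
      by (rule neutral_operator_diff_le[OF that])
  qed
  then obtain x where x: "\<And>t. nrm (x t) \<le> M" and "neutral_operator x = x" by blast
  then show ?thesis using neutral_equation_iff_fixed_point[of x, OF x] by blast
qed

lemma contraction_constant_dichotomy:
  assumes M: "0 < M" "E1 * M + b + ((N + 1) * (E1 * M + b) + 2 * E2 * M + a) * green_bound \<le> M"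
  shows "contraction_constant < 1 \<or> a = 0 \<and> b = 0"
proof (rule disjCI)
  assume "\<not> (a = 0 \<and> b = 0)"
  moreover have "0 \<le> a" "0 \<le> b"
    using G_zero_le[of 0] Q_zero_le[of 0] nrm_ge_0 order_trans by blast+
  \<comment> \<open>This is the part of the smallness condition free of \<open>M\<close>. If
    \<open>b = 0\<close>, its positivity comes from \<open>a * green_bound\<close>.\<close>
  ultimately have "0 < b + ((N + 1) * b + a) * green_bound"
    using green_bound_pos N_nonneg
    by (cases "b = 0") (auto intro!: add_pos_nonneg mult_nonneg_nonneg)
  moreover have "contraction_constant * M + (b + ((N + 1) * b + a) * green_bound) \<le> M"
    using M(2) by (simp add: contraction_constant_def algebra_simps)
  ultimately have "contraction_constant * M < 1 * M" by simp
  then show "contraction_constant < 1" using M(1) by (simp only: mult_less_cancel_right_pos)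
qed

end

section \<open>The existence theorem from the two cases\<close>

theorem theorem6:
  fixes nrm :: "'k::{real_normed_field,euclidean_space} ^ 'n \<Rightarrow> real"
    and A X :: "int \<Rightarrow> 'k ^ 'n ^ 'n"
    and P :: "'k ^ 'n ^ 'n"
    and g :: "int \<Rightarrow> int"
    and Q :: "int \<Rightarrow> 'k ^ 'n \<Rightarrow> 'k ^ 'n"
    and G :: "int \<Rightarrow> 'k ^ 'n \<Rightarrow> 'k ^ 'n \<Rightarrow> 'k ^ 'n"
    and t0 :: int
    and E1 E2 \<alpha>1 \<alpha>2 \<beta>1 \<beta>2 a b M0 :: real
  assumes "vector_norm nrm"
    and "norm_compatible nrm A"
    and "\<And>t. g t > 0"
    and "\<And>t. continuous_on UNIV (Q t)"
    and "\<And>t. continuous_on UNIV (\<lambda>(u, v). G t u v)"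
    and "\<And>t. invertible (A t)"
    and "principal_fundamental_matrix A t0 X"
    and "discrete_aa A"
    and "discrete_aa (\<lambda>t. real_of_int (g t))"
    and "discrete_aa_param Q"
    and "discrete_aa_param (\<lambda>t (u, v). G t u v)"
    and "0 < E1" and "E1 < 1"
    and "\<And>t \<zeta> \<psi>. nrm (Q t \<zeta> - Q t \<psi>) \<le> E1 * nrm (\<zeta> - \<psi>)"
    and "0 < E2"
    and "\<And>t u v \<zeta> \<psi>. nrm (G t u \<zeta> - G t v \<psi>) \<le> E2 * (nrm (u - v) + nrm (\<zeta> - \<psi>))"
    and "exp_dichotomy nrm X P \<alpha>1 \<alpha>2 \<beta>1 \<beta>2"
    and "a = (SUP t. nrm (G t 0 0))"
    and "b = (SUP t. nrm (Q t 0))"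
    and "0 < M0"
    and "E1 * M0 + b +
           ((matrix_sup_norm A + 1) * (E1 * M0 + b) + 2 * E2 * M0 + a) *
             (\<beta>1 * ((1 + \<alpha>1) / \<alpha>1) + \<beta>2 / \<alpha>2) \<le> M0"
  shows "\<exists>x \<in> aa_ball nrm M0. dichotomy_solution X P (neutral_forcing Q G g x) x"
proof -
  interpret vector_norm_space nrm by unfold_locales (rule assms(1))
  have upper: "nrm (f t) \<le> (SUP t. nrm (f t))" if bounded: "bounded (range f)"
    for f :: "int \<Rightarrow> 'k ^ 'n" and t
  proof (rule cSUP_upper)
    obtain C where C: "C > 0" "\<And>v. nrm v \<le> C * norm v" using nrm_le_norm by blast
    obtain D where "\<And>s. norm (f s) \<le> D" using bounded unfolding bounded_iff by blast
    then have "nrm (f s) \<le> C * D" for s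
      using C(2)[of "f s"] mult_left_mono[of "norm (f s)" D C] C(1) by (smt (verit))
    then show "bdd_above (range (\<lambda>t. nrm (f t)))" by (intro bdd_aboveI2)
  qed simp
  have "nrm (Q t 0) \<le> b" and "nrm (G t 0 0) \<le> a" for t
    using upper[OF discrete_aa_param_bounded[OF assms(10), of 0]]
      upper[OF discrete_aa_param_bounded[OF assms(11), of "(0, 0)"]]
    unfolding assms(18,19) by simp_all
  \<comment> \<open>Compatibility of the norms is what allows the row-sum norm of \<open>A\<close>
    as the operator bound \<open>N\<close>.\<close>
  then interpret neutral_system nrm A X P t0 \<alpha>1 \<alpha>2 \<beta>1 \<beta>2 Q G g "matrix_sup_norm A" E1 E2 a b
    using assms(2,6,7,12,14-17) by unfold_locales (auto simp: norm_compatible_def)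
  have M0: "E1 * M0 + b + ((matrix_sup_norm A + 1) * (E1 * M0 + b) + 2 * E2 * M0 + a) * green_bound \<le> M0"
    using assms(21) unfolding green_bound_def .
  have "\<exists>x. discrete_aa x \<and> (\<forall>t. nrm (x t) \<le> M0) \<and>
      (\<forall>t. x (t + 1) = A t *v x t + neutral_forcing Q G g x t)"
    using contraction_constant_dichotomy[OF assms(20) M0]
  proof
    assume L: "contraction_constant < 1"
    then obtain x where "\<And>t. nrm (x t) \<le> M0"
      and "\<And>t. x (t + 1) = A t *v x t + neutral_forcing Q G g x t"
      using exists_bounded_solution[OF L _ M0] assms(20) by auto
    with bounded_equation_discrete_aa[OF L] assms(8-11) show ?thesis by blast
  next
    \<comment> \<open>Here the contraction constant may equal 1, so the solution is exhibited
      directly: the forcing along the zero function vanishes.\<close>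
    assume "a = 0 \<and> b = 0"
    then have "Q t 0 = 0" "G t 0 0 = 0" for t
      using Q_zero_le[of t] G_zero_le[of t] by simp_all
    then show ?thesis
      using assms(20) by (intro exI[of _ "\<lambda>_. 0"])
        (auto simp: discrete_aa_const neutral_forcing_def fwd_diff_def)
  qed
  then obtain x where aa: "discrete_aa x" and le: "\<And>t. nrm (x t) \<le> M0"
    and eq: "\<And>t. x (t + 1) = A t *v x t + neutral_forcing Q G g x t" by blast
  have "x \<in> aa_ball nrm M0"
    using aa le by (auto simp: aa_ball_def sup_norm_def intro: cSUP_least)
  with dichotomy_solution_of_equation[OF le eq] show ?thesis by blast
qed

end
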